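(* Let $\Omega\subseteq\mathbf{R}$ be a closed interval (possibly unbounded) of length at least $1$. Then $\mathrm{P}^2_\Omega$ is nonexpansive, i.e. $$W_2\big(\mathrm{P}^2_\Omega[\mu],\mathrm{P}^2_\Omega[\nu]\big)\le W_2(\mu,\nu)\qquad\text{for all }\mu,\nu\in\mathcal{P}_2(\Omega).$$
   Context: For a closed convex set $\Omega\subseteq\mathbf{R}^d$ (here $d=1$) and $p\ge1$, $\mathcal{P}_p(\Omega)$ is the set of Borel probability measures supported in $\Omega$ with finite $p$-th moment, and $W_p$ is the $p$-Wasserstein distance for the cost $|x-y|^p$. Let $\mathcal{K}_p(\Omega)$ be the set of $\rho\in\mathcal{P}_p(\Omega)$ that are absolutely continuous with respect to Lebesgue measure with density satisfying $0\le\rho\le1$ a.e. For $p>1$ and $\mathcal{L}^d(\Omega)\ge1$, $\mathrm{P}^p_\Omega[\mu]$ denotes the metric projection of $\mu\in\mathcal{P}_p(\Omega)$ onto $\mathcal{K}_p(\Omega)$, i.e. the minimizer of $\rho\mapsto W_p^p(\rho,\mu)$ over $\rho\in\mathcal{K}_p(\Omega)$, which is known to exist and be unique. *)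

theory Defs
  imports "HOL-Probability.Probability"
begin

text \<open>As \<open>\<Omega>\<close> is always closed and the ambient space is second countable, a Borel measure is
  supported in \<open>\<Omega>\<close> exactly when the complement of \<open>\<Omega>\<close> is a null set.\<close>

definition prob_measures_moment ::
  "real \<Rightarrow> 'a::euclidean_space set \<Rightarrow> 'a measure set" where
  "prob_measures_moment p \<Omega> =
    {\<mu>. prob_space \<mu> \<and> sets \<mu> = sets borel \<and> emeasure \<mu> (- \<Omega>) = 0 \<and>
        (\<integral>\<^sup>+ x. ennreal (norm x powr p) \<partial>\<mu>) < \<infinity>}"

definition couplings ::
  "'a::euclidean_space measure \<Rightarrow> 'a measure \<Rightarrow> ('a \<times> 'a) measure set" where
  "couplings \<mu> \<nu> =
    {\<gamma>. sets \<gamma> = sets (borel \<Otimes>\<^sub>M borel) \<and> distr \<gamma> borel fst = \<mu> \<and> distr \<gamma> borel snd = \<nu>}"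

text \<open>The transport cost is the \<open>p\<close>-th power of the Wasserstein distance, with values in
  \<open>[0, \<infinity>]\<close>. It is finite between measures with finite \<open>p\<close>-th moment, so the conversion to a
  real number in \<open>wasserstein\<close> loses nothing there.\<close>

definition transport_cost ::
  "real \<Rightarrow> 'a::euclidean_space measure \<Rightarrow> 'a measure \<Rightarrow> ennreal" where
  "transport_cost p \<mu> \<nu> =
    (INF \<gamma>\<in>couplings \<mu> \<nu>. \<integral>\<^sup>+ z. ennreal (norm (fst z - snd z) powr p) \<partial>\<gamma>)"

definition wasserstein ::
  "real \<Rightarrow> 'a::euclidean_space measure \<Rightarrow> 'a measure \<Rightarrow> real" where
  "wasserstein p \<mu> \<nu> = enn2real (transport_cost p \<mu> \<nu>) powr (1 / p)"

definition bounded_density_measures ::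
  "real \<Rightarrow> 'a::euclidean_space set \<Rightarrow> 'a measure set" where
  "bounded_density_measures p \<Omega> =
    {\<rho> \<in> prob_measures_moment p \<Omega>.
      \<exists>f :: 'a \<Rightarrow> real. f \<in> borel_measurable borel \<and>
        (AE x in lborel. 0 \<le> f x \<and> f x \<le> 1) \<and>
        \<rho> = density lborel (\<lambda>x. ennreal (f x))}"

text \<open>The definite description is meaningful for \<open>p > 1\<close>, closed convex \<open>\<Omega>\<close> of Lebesgue measure
  at least 1 and \<open>\<mu> \<in> prob_measures_moment p \<Omega>\<close>, where the minimizer exists and is unique.\<close>

definition wasserstein_projection ::
  "real \<Rightarrow> 'a::euclidean_space set \<Rightarrow> 'a measure \<Rightarrow> 'a measure" where
  "wasserstein_projection p \<Omega> \<mu> =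
    (THE \<rho>. is_arg_min (\<lambda>\<rho>. transport_cost p \<rho> \<mu>)
              (\<lambda>\<rho>. \<rho> \<in> bounded_density_measures p \<Omega>) \<rho>)"

end

theory Submission
  imports Defs
begin

text \<open>On the line, \<open>W\<^sub>2\<close> is the \<open>L\<^sup>2(0,1)\<close> distance of the quantile functions. To see this, write
  \<open>(x - y)\<^sup>2\<close> as the area of the square with corners \<open>(x, x)\<close> and \<open>(y, y)\<close>. By Tonelli, the cost of a
  coupling then becomes an integral of the probabilities \<open>\<gamma>(x \<le> a, b < y)\<close> and \<open>\<gamma>(y \<le> a, b < x)\<close>. They
  are at least \<open>F a - G b\<close> and \<open>G a - F b\<close>, respectively, and the coupling by quantiles attains the
  positive parts of these bounds. A law on \<open>\<Omega>\<close> has density at most 1 exactly when its quantile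
  function \<open>q\<close> satisfies \<open>q t - q s \<ge> t - s\<close> for \<open>s < t\<close>. These functions form a closed convex set in
  \<open>L\<^sup>2(0,1)\<close>, and the metric projection onto a closed convex set in a Hilbert space exists, is unique,
  and is nonexpansive.\<close>

section \<open>Projection onto closed convex sets in \<open>L\<^sup>2\<close>\<close>

definition L2 :: "'a measure \<Rightarrow> ('a \<Rightarrow> real) set" where
  "L2 M = {f \<in> borel_measurable M. integrable M (\<lambda>x. (f x)\<^sup>2)}"

text \<open>The distance stays squared: it is then a polynomial along segments and matches the
  quadratic cost. It is meaningful on \<open>L2 M\<close>, since the Bochner integral of a
  non-integrable function is 0.\<close>

definition sqdist :: "'a measure \<Rightarrow> ('a \<Rightarrow> real) \<Rightarrow> ('a \<Rightarrow> real) \<Rightarrow> real" where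
  "sqdist M f g = (\<integral>x. (f x - g x)\<^sup>2 \<partial>M)"

lemma L2_measurable: "f \<in> L2 M \<Longrightarrow> f \<in> borel_measurable M"
  by (simp add: L2_def)

lemma L2_integrable_mult:
  assumes "f \<in> L2 M" "g \<in> L2 M"
  shows "integrable M (\<lambda>x. f x * g x)"
proof (rule Bochner_Integration.integrable_bound)
  show "integrable M (\<lambda>x. (f x)\<^sup>2 + (g x)\<^sup>2)"
    using assms by (simp add: L2_def)
  show "(\<lambda>x. f x * g x) \<in> borel_measurable M"
    using assms unfolding L2_def by auto
  have "\<bar>f x * g x\<bar> \<le> (f x)\<^sup>2 + (g x)\<^sup>2" for x
    using sum_squares_bound[of "\<bar>f x\<bar>" "\<bar>g x\<bar>"] abs_ge_zero[of "f x * g x"]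
    unfolding abs_mult[symmetric] power2_abs mult.assoc by linarith
  then show "AE x in M. norm (f x * g x) \<le> norm ((f x)\<^sup>2 + (g x)\<^sup>2)"
    by simp
qed

lemma L2_add: "f \<in> L2 M \<Longrightarrow> g \<in> L2 M \<Longrightarrow> (\<lambda>x. f x + g x) \<in> L2 M"
  using L2_integrable_mult[of f M g]
  by (auto simp: L2_def power2_sum mult.assoc)

lemma L2_scale: "f \<in> L2 M \<Longrightarrow> (\<lambda>x. c * f x) \<in> L2 M"
  by (auto simp: L2_def power_mult_distrib)

lemma L2_diff: "f \<in> L2 M \<Longrightarrow> g \<in> L2 M \<Longrightarrow> (\<lambda>x. f x - g x) \<in> L2 M"
  using L2_add[OF _ L2_scale[of g M "-1"], of f] by simp

lemma sqdist_nonneg: "0 \<le> sqdist M f g"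
  by (simp add: sqdist_def)

lemma sqdist_commute: "sqdist M f g = sqdist M g f"
  by (simp add: sqdist_def power2_commute)

lemma nn_integral_sqdist:
  assumes "f \<in> L2 M" "g \<in> L2 M"
  shows "(\<integral>\<^sup>+x. ennreal ((f x - g x)\<^sup>2) \<partial>M) = ennreal (sqdist M f g)"
  using L2_diff[OF assms] unfolding sqdist_def L2_def
  by (intro nn_integral_eq_integral) auto

lemma sqdist_eq_0:
  assumes "f \<in> L2 M" "g \<in> L2 M"
  shows "sqdist M f g = 0 \<longleftrightarrow> (AE x in M. f x = g x)"
  using L2_diff[OF assms] unfolding sqdist_def L2_def
  by (subst integral_nonneg_eq_0_iff_AE) auto

text \<open>Expansion of the square of \<open>(f - h) + u * (g - f)\<close>. The coefficient of
  \<open>u\<close> yields the variational inequality; eliminating it between two values of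
  \<open>u\<close> yields the parallelogram law.\<close>

lemma sqdist_segment:
  assumes "f \<in> L2 M" "g \<in> L2 M" "h \<in> L2 M"
  shows "sqdist M (\<lambda>x. f x + u * (g x - f x)) h =
    sqdist M f h + 2 * u * (\<integral>x. (f x - h x) * (g x - f x) \<partial>M) + u\<^sup>2 * sqdist M g f"
proof -
  have [simp]: "integrable M (\<lambda>x. (f x - h x)\<^sup>2)" "integrable M (\<lambda>x. (g x - f x)\<^sup>2)"
      "integrable M (\<lambda>x. (f x - h x) * (g x - f x))"
    using L2_diff[OF assms(1,3)] L2_diff[OF assms(2,1)] L2_integrable_mult[OF L2_diff[OF assms(1,3)] L2_diff[OF assms(2,1)]]
    by (simp_all add: L2_def)
  have "(\<lambda>x. (f x + u * (g x - f x) - h x)\<^sup>2) =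
     (\<lambda>x. (f x - h x)\<^sup>2 + 2 * u * ((f x - h x) * (g x - f x)) + u\<^sup>2 * (g x - f x)\<^sup>2)"
    by (rule ext) (simp add: power2_eq_square algebra_simps)
  then show ?thesis
    unfolding sqdist_def by simp
qed

text \<open>The parallelogram law: two functions that nearly minimize the distance to
  \<open>h\<close>, and whose midpoint does no better, are close to each other.\<close>

lemma sqdist_midpoint:
  assumes "f \<in> L2 M" "g \<in> L2 M" "h \<in> L2 M"
  shows "sqdist M g f = 2 * sqdist M f h + 2 * sqdist M g h
    - 4 * sqdist M (\<lambda>x. f x + 1/2 * (g x - f x)) h"
  using sqdist_segment[OF assms, of "1/2"] sqdist_segment[OF assms, of 1]
  by (simp add: power2_eq_square field_simps)

text \<open>Closedness refers to limits almost everywhere. This implies closedness in norm, as norm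
  convergence gives a subsequence converging almost everywhere, and it suits the limit built in the
  existence proof.\<close>

locale L2_closed_convex = finite_measure M for M :: "'a measure" +
  fixes C :: "('a \<Rightarrow> real) set"
  assumes subset_L2: "C \<subseteq> L2 M"
    and convex: "f \<in> C \<Longrightarrow> g \<in> C \<Longrightarrow> 0 \<le> u \<Longrightarrow> u \<le> 1 \<Longrightarrow> (\<lambda>x. f x + u * (g x - f x)) \<in> C"
    and closed: "(\<And>n. F n \<in> C) \<Longrightarrow> f \<in> L2 M \<Longrightarrow> AE x in M. (\<lambda>n. F n x) \<longlonglongrightarrow> f x \<Longrightarrow> f \<in> C"
begin

text \<open>The midpoint is in \<open>C\<close> and no closer to \<open>h\<close> than either
  minimizer, so the parallelogram law forces their distance to vanish.\<close>

lemma minimizers_AE_eq: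
  assumes "h \<in> L2 M" "f \<in> C" "g \<in> C"
    and "\<And>k. k \<in> C \<Longrightarrow> sqdist M f h \<le> sqdist M k h"
    and "\<And>k. k \<in> C \<Longrightarrow> sqdist M g h \<le> sqdist M k h"
  shows "AE x in M. f x = g x"
proof -
  have L: "f \<in> L2 M" "g \<in> L2 M"
    using assms subset_L2 by auto
  have "(\<lambda>x. f x + 1/2 * (g x - f x)) \<in> C"
    using convex[OF assms(2,3), of "1/2"] by simp
  then have "sqdist M g f \<le> 0"
    using sqdist_midpoint[OF L assms(1)] assms(4)[of "\<lambda>x. f x + 1/2 * (g x - f x)"]
      assms(5)[of "\<lambda>x. f x + 1/2 * (g x - f x)"] by linarith
  then have "sqdist M f g = 0"
    using sqdist_nonneg[of M f g] by (simp add: sqdist_commute)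
  then show ?thesis
    using sqdist_eq_0[OF L] by simp
qed

text \<open>Along the segment from \<open>f\<close> to \<open>g\<close> the squared distance to
  \<open>h\<close> is least at \<open>u = 0\<close>; its right derivative there is twice this
  integral.\<close>

lemma variational_inequality:
  assumes "h \<in> L2 M" "f \<in> C" "g \<in> C"
    and min: "\<And>k. k \<in> C \<Longrightarrow> sqdist M f h \<le> sqdist M k h"
  shows "0 \<le> (\<integral>x. (f x - h x) * (g x - f x) \<partial>M)"
proof -
  define p where "p = (\<integral>x. (f x - h x) * (g x - f x) \<partial>M)"
  have L: "f \<in> L2 M" "g \<in> L2 M"
    using assms subset_L2 by auto
  have *: "0 \<le> 2 * p + u * sqdist M g f" if "0 < u" "u \<le> 1" for u
  proof -
    have "0 \<le> u * (2 * p + u * sqdist M g f)"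
      using min[OF convex[OF assms(2,3), of u]] sqdist_segment[OF L assms(1), of u] that
      by (simp add: p_def power2_eq_square algebra_simps)
    then show ?thesis
      using that by (simp add: zero_le_mult_iff)
  qed
  have "((\<lambda>u. 2 * p + u * sqdist M g f) \<longlongrightarrow> 2 * p + 0 * sqdist M g f) (at_right 0)"
    by (intro tendsto_intros)
  moreover have "eventually (\<lambda>u. 0 \<le> 2 * p + u * sqdist M g f) (at_right 0)"
    using eventually_at_right_real[of 0 "1::real", simplified]
    by eventually_elim (simp add: *)
  ultimately have "0 \<le> 2 * p + 0 * sqdist M g f"
    by (intro tendsto_lowerbound) auto
  then show ?thesis
    by (simp add: p_def)
qed

text \<open>Testing each minimizer against the other and adding the variational inequalities shows
  that the inner product of \<open>f - f'\<close> and \<open>h - h'\<close> is at least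
  \<open>sqdist M f f'\<close>.\<close>

lemma projection_nonexpansive:
  assumes h: "h \<in> L2 M" "h' \<in> L2 M" and f: "f \<in> C" "f' \<in> C"
    and min: "\<And>k. k \<in> C \<Longrightarrow> sqdist M f h \<le> sqdist M k h"
    and min': "\<And>k. k \<in> C \<Longrightarrow> sqdist M f' h' \<le> sqdist M k h'"
  shows "sqdist M f f' \<le> sqdist M h h'"
proof -
  have L: "f \<in> L2 M" "f' \<in> L2 M"
    using f subset_L2 by auto
  note [simp] = L2_integrable_mult[OF L2_diff[OF L(1) h(1)] L2_diff[OF L(2,1)]]
    L2_integrable_mult[OF L2_diff[OF L(2) h(2)] L2_diff[OF L]]
    L2_diff[OF L, unfolded L2_def, simplified] L2_diff[OF h, unfolded L2_def, simplified]
  have "0 \<le> (\<integral>x. 2 * ((f x - h x) * (f' x - f x)) + 2 * ((f' x - h' x) * (f x - f' x)) \<partial>M)"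
    using variational_inequality[OF h(1) f min] variational_inequality[OF h(2) f(2,1) min']
    by simp
  also have "\<dots> \<le> (\<integral>x. (h x - h' x)\<^sup>2 - (f x - f' x)\<^sup>2 \<partial>M)"
  proof (rule integral_mono)
    fix x
    \<comment> \<open>This square is exactly the difference of the two sides below.\<close>
    have "0 \<le> ((f x - f' x) - (h x - h' x))\<^sup>2"
      by simp
    then show "2 * ((f x - h x) * (f' x - f x)) + 2 * ((f' x - h' x) * (f x - f' x))
        \<le> (h x - h' x)\<^sup>2 - (f x - f' x)\<^sup>2"
      by (simp add: power2_eq_square algebra_simps)
  qed simp_all
  also have "\<dots> = sqdist M h h' - sqdist M f f'"
    by (simp add: sqdist_def)
  finally show ?thesis by simp
qed

text \<open>The core of the Riesz-Fischer theorem: on a finite measure space the absolute increments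
  have geometrically decaying integrals, so their sum is finite almost everywhere.\<close>

lemma AE_summable_if_sqdist_geometric:
  assumes F: "\<And>n. F n \<in> L2 M" and le: "\<And>n. sqdist M (F (Suc n)) (F n) \<le> 1 / 4 ^ n"
  shows "AE x in M. summable (\<lambda>n. F (Suc n) x - F n x)"
proof -
  have int: "integrable M (\<lambda>x. (F (Suc n) x - F n x)\<^sup>2)" for n
    using L2_diff[OF F F] by (simp add: L2_def)
  have [measurable]: "F n \<in> borel_measurable M" for n
    using F by (rule L2_measurable)
  have bd: "(\<integral>\<^sup>+x. ennreal \<bar>F (Suc n) x - F n x\<bar> \<partial>M) \<le> ennreal ((1 + measure M (space M)) * (1 / 2) ^ n)" for n
  proof -
    \<comment> \<open>The weight \<open>2 ^ n\<close> balances the terms: the squares integrate to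
      at most \<open>1 / 4 ^ n\<close>, so both terms contribute multiples of
      \<open>(1 / 2) ^ n\<close>.\<close>
    have "\<bar>F (Suc n) x - F n x\<bar> \<le> 2 ^ n * (F (Suc n) x - F n x)\<^sup>2 + (1 / 2) ^ n" for x
    proof -
      define a where "a = \<bar>F (Suc n) x - F n x\<bar>"
      have "0 \<le> a" by (simp add: a_def)
      moreover have "b \<le> b\<^sup>2 + 1" if "0 \<le> b" for b :: real
        using sum_squares_bound[of b 1] that by simp
      ultimately have "2 ^ n * a \<le> (2 ^ n * a)\<^sup>2 + 1"
        by simp
      then have "a \<le> 2 ^ n * a\<^sup>2 + (1 / 2) ^ n"
        by (simp add: field_simps power2_eq_square)
      then show ?thesis by (simp add: a_def)
    qed
    then have "(\<integral>\<^sup>+x. ennreal \<bar>F (Suc n) x - F n x\<bar> \<partial>M) \<le>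
      (\<integral>\<^sup>+x. ennreal (2 ^ n * (F (Suc n) x - F n x)\<^sup>2 + (1 / 2) ^ n) \<partial>M)"
      by (intro nn_integral_mono ennreal_leI) simp
    also have "\<dots> = ennreal (\<integral>x. 2 ^ n * (F (Suc n) x - F n x)\<^sup>2 + (1 / 2) ^ n \<partial>M)"
      using int by (intro nn_integral_eq_integral) auto
    also have "\<dots> = ennreal (2 ^ n * sqdist M (F (Suc n)) (F n) + measure M (space M) * (1 / 2) ^ n)"
      using int by (simp add: sqdist_def)
    also have "\<dots> \<le> ennreal (2 ^ n * (1 / 4 ^ n) + measure M (space M) * (1 / 2) ^ n)"
      by (intro ennreal_leI add_right_mono mult_left_mono le) simp
    also have "2 ^ n * (1 / 4 ^ n) = (1 / 2 :: real) ^ n"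
      by (simp add: power_divide[symmetric])
    finally show ?thesis
      by (simp add: distrib_right)
  qed
  have "(\<integral>\<^sup>+x. (\<Sum>n. ennreal \<bar>F (Suc n) x - F n x\<bar>) \<partial>M) = (\<Sum>n. \<integral>\<^sup>+x. ennreal \<bar>F (Suc n) x - F n x\<bar> \<partial>M)"
    by (intro nn_integral_suminf) auto
  also have "\<dots> \<le> (\<Sum>n. ennreal ((1 + measure M (space M)) * (1 / 2) ^ n))"
    by (intro suminf_le bd) auto
  also have "\<dots> < \<infinity>"
    by (subst suminf_ennreal2) (auto intro!: summable_mult summable_geometric)
  finally have "AE x in M. (\<Sum>n. ennreal \<bar>F (Suc n) x - F n x\<bar>) \<noteq> \<infinity>"
    by (intro nn_integral_PInf_AE) auto
  then show ?thesis
  proof eventually_elim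
    case (elim x)
    then show ?case
      by (intro summable_rabs_cancel[OF summable_suminf_not_top]) auto
  qed
qed

text \<open>The parallelogram law turns a fast minimizing sequence into one with geometrically small
  increments. It converges almost everywhere, and Fatou's lemma shows that the limit is a
  minimizer.\<close>

theorem projection_exists:
  assumes h: "h \<in> L2 M" and ne: "C \<noteq> {}"
  obtains f where "f \<in> C" "\<And>k. k \<in> C \<Longrightarrow> sqdist M f h \<le> sqdist M k h"
proof -
  define m where "m = (INF k\<in>C. sqdist M k h)"
  have bdd: "bdd_below ((\<lambda>k. sqdist M k h) ` C)"
    by (intro bdd_belowI2[of _ 0] sqdist_nonneg)
  have m_le: "m \<le> sqdist M k h" if "k \<in> C" for k
    unfolding m_def using bdd that by (rule cINF_lower)
  have "\<exists>k\<in>C. sqdist M k h < m + e" if "e > 0" for e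
    using cINF_less_iff[OF ne bdd, of "m + e"] that by (simp add: m_def)
  \<comment> \<open>With this rate, twice the sum of two consecutive errors stays below
    \<open>1 / 4 ^ n\<close>.\<close>
  then have "\<forall>n. \<exists>k. k \<in> C \<and> sqdist M k h < m + (1 / 4) ^ Suc n"
    by (metis zero_less_power zero_less_divide_1_iff zero_less_numeral)
  then obtain F where F: "\<And>n. F n \<in> C" and F_lt: "\<And>n. sqdist M (F n) h < m + (1 / 4) ^ Suc n"
    by metis
  have L: "F n \<in> L2 M" for n
    using F subset_L2 by auto
  have [measurable]: "F n \<in> borel_measurable M" "h \<in> borel_measurable M" for n
    using L h by (auto intro: L2_measurable)
  have "AE x in M. summable (\<lambda>n. F (Suc n) x - F n x)"
  proof (rule AE_summable_if_sqdist_geometric[OF L])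
    fix n
    have "m \<le> sqdist M (\<lambda>x. F n x + 1 / 2 * (F (Suc n) x - F n x)) h"
      using convex[OF F F, of "1/2" n "Suc n"] by (intro m_le) simp
    then have "sqdist M (F (Suc n)) (F n) \<le> 2 * (1 / 4) ^ Suc n + 2 * (1 / 4) ^ Suc (Suc n)"
      using sqdist_midpoint[OF L[of n] L[of "Suc n"] h] F_lt[of n] F_lt[of "Suc n"] by linarith
    also have "\<dots> \<le> 1 / 4 ^ n"
      by (simp add: power_divide field_simps)
    finally show "sqdist M (F (Suc n)) (F n) \<le> 1 / 4 ^ n" .
  qed
  then have conv: "AE x in M. (\<lambda>n. F n x) \<longlonglongrightarrow> lim (\<lambda>n. F n x)"
  proof eventually_elim
    case (elim x)
    then have "convergent (\<lambda>n. \<Sum>i<n. F (Suc i) x - F i x)"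
      by (simp add: summable_iff_convergent)
    then have "convergent (\<lambda>n. (\<Sum>i<n. F (Suc i) x - F i x) + F 0 x)"
      by (intro convergent_add convergent_const)
    then have "convergent (\<lambda>n. F n x)"
      by (simp add: sum_lessThan_telescope[of "\<lambda>i. F i x"])
    then show ?case
      by (simp add: convergent_LIMSEQ_iff)
  qed
  define f where "f = (\<lambda>x. lim (\<lambda>n. F n x))"
  have [measurable]: "f \<in> borel_measurable M"
    unfolding f_def by measurable
  \<comment> \<open>Fatou's lemma both bounds the distance of the limit by \<open>m\<close> and puts
    the limit into \<open>L2 M\<close>, without convergence in norm.\<close>
  have "(\<integral>\<^sup>+x. ennreal ((f x - h x)\<^sup>2) \<partial>M) = (\<integral>\<^sup>+x. liminf (\<lambda>n. ennreal ((F n x - h x)\<^sup>2)) \<partial>M)"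
  proof (rule nn_integral_cong_AE, use conv in eventually_elim)
    case (elim x)
    then have "(\<lambda>n. ennreal ((F n x - h x)\<^sup>2)) \<longlonglongrightarrow> ennreal ((f x - h x)\<^sup>2)"
      unfolding f_def by (intro tendsto_intros)
    then show ?case
      by (simp only: lim_imp_Liminf[OF sequentially_bot])
  qed
  also have "\<dots> \<le> liminf (\<lambda>n. \<integral>\<^sup>+x. ennreal ((F n x - h x)\<^sup>2) \<partial>M)"
    by (intro nn_integral_liminf) measurable
  also have "\<dots> = liminf (\<lambda>n. ennreal (sqdist M (F n) h))"
    by (simp add: nn_integral_sqdist[OF L h])
  also have "\<dots> \<le> liminf (\<lambda>n. ennreal (m + (1 / 4) ^ Suc n))"
    using F_lt by (intro Liminf_mono always_eventually allI ennreal_leI less_imp_le)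
  also have "\<dots> = ennreal (m + 0)"
    by (intro lim_imp_Liminf tendsto_intros LIMSEQ_Suc LIMSEQ_power_zero) auto
  finally have le: "(\<integral>\<^sup>+x. ennreal ((f x - h x)\<^sup>2) \<partial>M) \<le> ennreal m"
    by simp
  then have "(\<lambda>x. f x - h x) \<in> L2 M"
    unfolding L2_def by (auto simp: integrable_iff_bounded intro: le_less_trans)
  from L2_add[OF this h] have f: "f \<in> L2 M"
    by simp
  have "0 \<le> m"
    unfolding m_def using ne by (intro cINF_greatest sqdist_nonneg)
  show thesis
  proof
    show "f \<in> C"
      using conv by (intro closed[OF F f]) (simp add: f_def)
    show "sqdist M f h \<le> sqdist M k h" if "k \<in> C" for k
      using le m_le[OF that] \<open>0 \<le> m\<close> by (simp add: nn_integral_sqdist[OF f h])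
  qed
qed

end

section \<open>Optimal transport on the line\<close>

text \<open>At 0 and 1 the infimum defining a quantile can run over a set that is unbounded below or
  empty, so the end points are left out.\<close>

abbreviation unit_measure :: "real measure" where
  "unit_measure \<equiv> restrict_space lborel {0<..<1}"

lemma space_unit_measure: "space unit_measure = {0<..<1}"
  by (simp add: space_restrict_space)

interpretation unit_measure: prob_space unit_measure
  by (rule prob_spaceI) (simp add: emeasure_restrict_space space_restrict_space)

lemma AE_unit_measure: "AE t in unit_measure. 0 < t \<and> t < 1"
  by (rule AE_I2) (simp add: space_unit_measure)

definition quantile :: "real measure \<Rightarrow> real \<Rightarrow> real" where
  "quantile \<mu> t = Inf {x. t \<le> cdf \<mu> x}"

context cdf_distribution
begin

text \<open>\<open>I\<close> is the pseudoinverse of the distribution function from the proof of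
  Skorohod's theorem; its adjunction with \<open>cdf\<close> and its law carry over.\<close>

lemma quantile_eq_I: "quantile M = I"
  by (simp add: quantile_def fun_eq_iff)

lemma quantile_le_iff: "0 < t \<Longrightarrow> t < 1 \<Longrightarrow> quantile M t \<le> x \<longleftrightarrow> t \<le> cdf M x"
  unfolding quantile_eq_I by (rule pseudoinverse[symmetric])

lemma measurable_quantile [measurable]: "quantile M \<in> borel_measurable unit_measure"
  using measurable_CI unfolding quantile_eq_I by (simp cong: measurable_cong_sets add: sets_restrict_space)

lemma distr_quantile: "distr unit_measure borel (quantile M) = M"
  unfolding quantile_eq_I by (rule distr_I_eq_M)

end

text \<open>One of the two squares is empty. With \<open>a\<close> and \<open>b\<close> the minimum
  and maximum of the coordinates, lying in a square reads \<open>x \<le> a\<close> and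
  \<open>b < y\<close>, a form that distribution functions can bound.\<close>

lemma power2_diff_eq_nn_integral:
  fixes x y :: real
  shows "ennreal ((x - y)\<^sup>2) = (\<integral>\<^sup>+w.
    (if x \<le> min (fst w) (snd w) \<and> max (fst w) (snd w) < y then 1 else 0) +
    (if y \<le> min (fst w) (snd w) \<and> max (fst w) (snd w) < x then 1 else 0) \<partial>(lborel \<Otimes>\<^sub>M lborel))"
proof -
  have *: "(if x \<le> min (fst w) (snd w) \<and> max (fst w) (snd w) < y then 1 else 0 :: ennreal)
    = indicator ({x..<y} \<times> {x..<y}) w" for x y :: real and w
    by (cases w) (auto simp: indicator_def)
  have "(\<integral>\<^sup>+w. indicator ({x..<y} \<times> {x..<y}) w + indicator ({y..<x} \<times> {y..<x}) w \<partial>(lborel \<Otimes>\<^sub>M lborel))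
    = emeasure (lborel \<Otimes>\<^sub>M lborel) ({x..<y} \<times> {x..<y}) + emeasure (lborel \<Otimes>\<^sub>M lborel) ({y..<x} \<times> {y..<x})"
    by (simp add: nn_integral_add)
  also have "\<dots> = ennreal ((x - y)\<^sup>2)"
    by (cases "x \<le> y")
      (simp_all add: lborel.emeasure_pair_measure_Times ennreal_mult[symmetric] power2_eq_square algebra_simps)
  finally show ?thesis
    by (simp only: *)
qed

lemma (in prob_space) nn_integral_power2_diff:
  assumes [measurable]: "random_variable borel X" "random_variable borel Y"
  shows "(\<integral>\<^sup>+z. ennreal ((X z - Y z)\<^sup>2) \<partial>M) = (\<integral>\<^sup>+w.
    emeasure M {z \<in> space M. X z \<le> min (fst w) (snd w) \<and> max (fst w) (snd w) < Y z} +
    emeasure M {z \<in> space M. Y z \<le> min (fst w) (snd w) \<and> max (fst w) (snd w) < X z} \<partial>(lborel \<Otimes>\<^sub>M lborel))"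
proof -
  interpret L: pair_sigma_finite lborel "lborel :: real measure" ..
  interpret P: pair_sigma_finite M "lborel \<Otimes>\<^sub>M lborel :: (real \<times> real) measure" ..
  have "(\<integral>\<^sup>+z. ennreal ((X z - Y z)\<^sup>2) \<partial>M) = (\<integral>\<^sup>+z. \<integral>\<^sup>+w.
    (if X z \<le> min (fst w) (snd w) \<and> max (fst w) (snd w) < Y z then 1 else 0) +
    (if Y z \<le> min (fst w) (snd w) \<and> max (fst w) (snd w) < X z then 1 else 0) \<partial>(lborel \<Otimes>\<^sub>M lborel) \<partial>M)"
    by (simp only: power2_diff_eq_nn_integral)
  also have "\<dots> = (\<integral>\<^sup>+w. \<integral>\<^sup>+z.
    (if X z \<le> min (fst w) (snd w) \<and> max (fst w) (snd w) < Y z then 1 else 0) +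
    (if Y z \<le> min (fst w) (snd w) \<and> max (fst w) (snd w) < X z then 1 else 0) \<partial>M \<partial>(lborel \<Otimes>\<^sub>M lborel))"
    by (rule P.Fubini'[symmetric]) measurable
  also have "\<dots> = (\<integral>\<^sup>+w. \<integral>\<^sup>+z.
    indicator {z \<in> space M. X z \<le> min (fst w) (snd w) \<and> max (fst w) (snd w) < Y z} z +
    indicator {z \<in> space M. Y z \<le> min (fst w) (snd w) \<and> max (fst w) (snd w) < X z} z \<partial>M \<partial>(lborel \<Otimes>\<^sub>M lborel))"
    by (intro nn_integral_cong arg_cong2[where f = "(+)"]) (auto simp: indicator_def)
  finally show ?thesis
    by (simp add: nn_integral_add)
qed

text \<open>By the adjunction the event is \<open>cdf \<nu> b < t\<close> and
  \<open>t \<le> cdf \<mu> a\<close>. As \<open>ennreal\<close> sends negative numbers to 0, the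
  right side is the positive part.\<close>

lemma emeasure_quantiles:
  assumes "real_distribution \<mu>" "real_distribution \<nu>"
  shows "emeasure unit_measure {t \<in> space unit_measure. quantile \<mu> t \<le> a \<and> b < quantile \<nu> t}
    = ennreal (cdf \<mu> a - cdf \<nu> b)"
proof -
  interpret \<mu>: cdf_distribution \<mu> by (simp add: cdf_distribution_def assms)
  interpret \<nu>: cdf_distribution \<nu> by (simp add: cdf_distribution_def assms)
  have "{t \<in> space unit_measure. quantile \<mu> t \<le> a \<and> b < quantile \<nu> t} =
      {t. 0 < t \<and> t < 1 \<and> t \<le> cdf \<mu> a \<and> cdf \<nu> b < t}"
    by (auto simp: space_unit_measure \<mu>.quantile_le_iff \<nu>.quantile_le_iff simp flip: not_le)
  \<comment> \<open>The right end point lies in the open unit interval only if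
    \<open>cdf \<mu> a < 1\<close>.\<close>
  also have "\<dots> = (if cdf \<mu> a < 1 then {cdf \<nu> b<..cdf \<mu> a} else {cdf \<nu> b<..<1})"
    using \<mu>.cdf_bounded_prob[of a] \<nu>.cdf_nonneg[of b] by auto
  finally have eq: "{t \<in> space unit_measure. quantile \<mu> t \<le> a \<and> b < quantile \<nu> t} =
      (if cdf \<mu> a < 1 then {cdf \<nu> b<..cdf \<mu> a} else {cdf \<nu> b<..<1})" .
  show ?thesis
    unfolding eq
    using \<mu>.cdf_bounded_prob[of a] \<nu>.cdf_bounded_prob[of b] \<nu>.cdf_nonneg[of b]
    by (subst emeasure_restrict_space; cases "cdf \<nu> b \<le> cdf \<mu> a") (auto simp: ennreal_neg)
qed

lemma couplingsD:
  fixes \<mu> \<nu> :: "real measure"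
  assumes "\<gamma> \<in> couplings \<mu> \<nu>"
  shows "sets \<gamma> = sets (borel \<Otimes>\<^sub>M borel)" "space \<gamma> = UNIV"
    "fst \<in> borel_measurable \<gamma>" "snd \<in> borel_measurable \<gamma>" "distr \<gamma> borel fst = \<mu>" "distr \<gamma> borel snd = \<nu>"
proof -
  show s: "sets \<gamma> = sets (borel \<Otimes>\<^sub>M borel)"
    using assms by (simp add: couplings_def)
  show "space \<gamma> = UNIV"
    using sets_eq_imp_space_eq[OF s] by (simp add: space_pair_measure)
  show "fst \<in> borel_measurable \<gamma>" "snd \<in> borel_measurable \<gamma>"
    by (simp_all add: measurable_cong_sets[OF s refl])
  show "distr \<gamma> borel fst = \<mu>" "distr \<gamma> borel snd = \<nu>"
    using assms by (simp_all add: couplings_def)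
qed

lemma prob_space_coupling:
  fixes \<mu> :: "real measure"
  assumes "\<gamma> \<in> couplings \<mu> \<nu>" "prob_space \<mu>"
  shows "prob_space \<gamma>"
  using couplingsD[OF assms(1)] assms(2) prob_space_distrD by blast

text \<open>The joint event and \<open>Y \<le> b\<close> together cover \<open>X \<le> a\<close>.
  The bound depends on the marginals only, so it is common to all couplings.\<close>

lemma cdf_diff_le_emeasure:
  assumes "prob_space \<gamma>" and [measurable]: "X \<in> borel_measurable \<gamma>" "Y \<in> borel_measurable \<gamma>"
  shows "ennreal (cdf (distr \<gamma> borel X) a - cdf (distr \<gamma> borel Y) b)
    \<le> emeasure \<gamma> {z \<in> space \<gamma>. X z \<le> a \<and> b < Y z}"
proof -
  interpret prob_space \<gamma> by fact
  have "measure \<gamma> {z \<in> space \<gamma>. X z \<le> a}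
     \<le> measure \<gamma> ({z \<in> space \<gamma>. X z \<le> a \<and> b < Y z} \<union> {z \<in> space \<gamma>. Y z \<le> b})"
    by (intro finite_measure_mono) auto
  also have "\<dots> \<le> measure \<gamma> {z \<in> space \<gamma>. X z \<le> a \<and> b < Y z} + measure \<gamma> {z \<in> space \<gamma>. Y z \<le> b}"
    by (intro measure_Un_le) auto
  finally have "cdf (distr \<gamma> borel X) a - cdf (distr \<gamma> borel Y) b \<le> measure \<gamma> {z \<in> space \<gamma>. X z \<le> a \<and> b < Y z}"
    by (simp add: cdf_def measure_distr vimage_def Int_def conj_commute)
  then show ?thesis
    by (simp add: emeasure_eq_measure ennreal_leI)
qed

lemma transport_cost_2:
  fixes \<mu> \<nu> :: "real measure"
  shows "transport_cost 2 \<mu> \<nu> = (INF \<gamma>\<in>couplings \<mu> \<nu>. \<integral>\<^sup>+ z. ennreal ((fst z - snd z)\<^sup>2) \<partial>\<gamma>)"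
  unfolding transport_cost_def by (simp add: powr_numeral)

text \<open>The joint law of \<open>X\<close> and \<open>Y\<close> is a coupling. Since they need
  not be quantile functions, expanding functions can later compete without being rearranged.\<close>

lemma transport_cost_distr_le:
  assumes [measurable]: "X \<in> borel_measurable M" "Y \<in> borel_measurable M"
  shows "transport_cost 2 (distr M borel X) (distr M borel Y) \<le> (\<integral>\<^sup>+z. ennreal ((X z - Y z)\<^sup>2) \<partial>M)"
proof -
  let ?g = "distr M (borel \<Otimes>\<^sub>M borel) (\<lambda>z. (X z, Y z :: real))"
  have "?g \<in> couplings (distr M borel X) (distr M borel Y)"
    by (simp add: couplings_def distr_distr comp_def)
  then have "transport_cost 2 (distr M borel X) (distr M borel Y) \<le> (\<integral>\<^sup>+ z. ennreal ((fst z - snd z)\<^sup>2) \<partial>?g)"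
    unfolding transport_cost_2 by (rule INF_lower)
  also have "\<dots> = (\<integral>\<^sup>+z. ennreal ((X z - Y z)\<^sup>2) \<partial>M)"
    by (subst nn_integral_distr) auto
  finally show ?thesis .
qed

theorem transport_cost_eq_quantiles:
  assumes "real_distribution \<mu>" "real_distribution \<nu>"
  shows "transport_cost 2 \<mu> \<nu> = (\<integral>\<^sup>+t. ennreal ((quantile \<mu> t - quantile \<nu> t)\<^sup>2) \<partial>unit_measure)"
proof (rule antisym)
  interpret \<mu>: cdf_distribution \<mu> by (simp add: cdf_distribution_def assms)
  interpret \<nu>: cdf_distribution \<nu> by (simp add: cdf_distribution_def assms)
  show "transport_cost 2 \<mu> \<nu> \<le> (\<integral>\<^sup>+t. ennreal ((quantile \<mu> t - quantile \<nu> t)\<^sup>2) \<partial>unit_measure)"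
    using transport_cost_distr_le[OF \<mu>.measurable_quantile \<nu>.measurable_quantile]
    by (simp only: \<mu>.distr_quantile \<nu>.distr_quantile)
  show "(\<integral>\<^sup>+t. ennreal ((quantile \<mu> t - quantile \<nu> t)\<^sup>2) \<partial>unit_measure) \<le> transport_cost 2 \<mu> \<nu>"
    unfolding transport_cost_2
  proof (rule INF_greatest)
    fix \<gamma> assume \<gamma>: "\<gamma> \<in> couplings \<mu> \<nu>"
    note [measurable] = couplingsD(3,4)[OF \<gamma>]
    interpret \<gamma>: prob_space \<gamma>
      using \<gamma> by (rule prob_space_coupling) unfold_locales
    show "(\<integral>\<^sup>+t. ennreal ((quantile \<mu> t - quantile \<nu> t)\<^sup>2) \<partial>unit_measure)
        \<le> (\<integral>\<^sup>+ z. ennreal ((fst z - snd z)\<^sup>2) \<partial>\<gamma>)"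
      \<comment> \<open>Both costs become integrals over the same pairs and compare integrand by
        integrand: the quantile coupling attains the bounds valid for every coupling.\<close>
      unfolding \<gamma>.nn_integral_power2_diff[OF couplingsD(3,4)[OF \<gamma>]]
        unit_measure.nn_integral_power2_diff[OF \<mu>.measurable_quantile \<nu>.measurable_quantile]
        emeasure_quantiles[OF assms] emeasure_quantiles[OF assms(2,1)]
      using cdf_diff_le_emeasure[OF \<gamma>.prob_space_axioms couplingsD(3,4)[OF \<gamma>]]
        cdf_diff_le_emeasure[OF \<gamma>.prob_space_axioms couplingsD(4,3)[OF \<gamma>]]
      unfolding couplingsD(5,6)[OF \<gamma>] by (intro nn_integral_mono add_mono)
  qed
qed

section \<open>Densities bounded by 1\<close>

text \<open>The complementary measure with distribution function \<open>x - cdf M x\<close> adds up with \<open>M\<close> to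
  Lebesgue measure.\<close>

lemma (in real_distribution) emeasure_le_lborel:
  assumes Ioc: "\<And>a b. a \<le> b \<Longrightarrow> measure M {a<..b} \<le> b - a" and A: "A \<in> sets borel"
  shows "emeasure M A \<le> emeasure lborel A"
proof -
  define N where "N = interval_measure (\<lambda>x. x - cdf M x)"
  define S where "S = measure_of UNIV (sets borel) (\<lambda>A. emeasure M A + emeasure N A)"
  have sets_N: "sets N = sets borel"
    by (simp add: N_def)
  have N_Ioc: "emeasure N {a<..b} = ennreal (b - a - measure M {a<..b})" if "a \<le> b" for a b
  proof (cases "a = b")
    case False
    \<comment> \<open>The bound on intervals makes \<open>x - cdf M x\<close> nondecreasing, so that
      it defines a measure.\<close>
    have "x - cdf M x \<le> y - cdf M y" if "x \<le> y" for x y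
      using Ioc[OF that] cdf_diff_eq[of x y] that by (cases "x = y") auto
    moreover have "continuous (at_right x) (\<lambda>x. x - cdf M x)" for x
      by (intro continuous_intros cdf_is_right_cont)
    ultimately have "emeasure N {a<..b} = ennreal ((b - cdf M b) - (a - cdf M a))"
      unfolding N_def using that by (intro emeasure_interval_measure_Ioc)
    then show ?thesis
      using cdf_diff_eq[of a b] that False by (simp add: algebra_simps)
  qed simp
  have sets_S: "sets S = sets borel"
    using sets.sigma_sets_eq[of borel] by (simp add: S_def)
  have S: "emeasure S B = emeasure M B + emeasure N B" if "B \<in> sets borel" for B
  proof (rule emeasure_measure_of[OF S_def])
    show "countably_additive (sets S) (\<lambda>A. emeasure M A + emeasure N A)"
      unfolding countably_additive_def
      by (auto simp: sets_S sets_N suminf_emeasure suminf_add[symmetric] image_subset_iff M_is_borel)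
  qed (use that in \<open>auto simp: sets_S positive_def\<close>)
  have "lborel = S"
  proof (rule measure_eqI_generator_eq[where \<Omega>=UNIV and E="range (\<lambda>(a, b). {a<..b::real})"])
    show "range (\<lambda>i::nat. {- real i<..real i}) \<subseteq> range (\<lambda>(a, b). {a<..b})"
      by auto
    show "(\<Union>i::nat. {- real i<..real i}) = UNIV"
      by (rule UN_Ioc_eq_UNIV)
    show "sets lborel = sigma_sets UNIV (range (\<lambda>(a, b). {a<..b::real}))"
      by (simp add: borel_sigma_sets_Ioc)
    show "sets S = sigma_sets UNIV (range (\<lambda>(a, b). {a<..b::real}))"
      by (simp add: sets_S borel_sigma_sets_Ioc)
    fix X assume "X \<in> range (\<lambda>(a, b). {a<..b::real})"
    then obtain a b where X: "X = {a<..b}" by auto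
    show "emeasure lborel X = emeasure S X"
    proof (cases "a \<le> b")
      case True
      then show ?thesis
        using Ioc[OF True] by (simp add: X S N_Ioc emeasure_eq_measure flip: ennreal_plus)
    qed (simp add: X)
  qed (auto simp: Int_stable_def)
  then show ?thesis
    using S[OF A] by simp
qed

text \<open>Domination gives a Radon-Nikodym density. Its averages over sets of finite positive
  Lebesgue measure are at most 1, hence so is the density almost everywhere.\<close>

lemma (in real_distribution) density_le_1I:
  assumes le: "\<And>A. A \<in> sets borel \<Longrightarrow> emeasure M A \<le> emeasure lborel A"
  obtains f :: "real \<Rightarrow> real" where "f \<in> borel_measurable borel"
    "AE x in lborel. 0 \<le> f x \<and> f x \<le> 1" "M = density lborel (\<lambda>x. ennreal (f x))"
proof -
  have "absolutely_continuous lborel M"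
    unfolding absolutely_continuous_def null_sets_def using le by (auto simp: le_zero_eq)
      (metis le_zero_eq)
  then obtain g where g [measurable]: "g \<in> borel_measurable lborel" and M: "density lborel g = M"
    using sigma_finite_measure.Radon_Nikodym[OF sigma_finite_lborel, of M] by (auto simp: M_is_borel)
  have g_int: "(\<integral>\<^sup>+x. g x \<partial>lborel) = 1"
    using emeasure_space_1 unfolding M[symmetric] by (simp add: emeasure_density)
  then have fin: "AE x in lborel. g x \<noteq> \<infinity>"
    by (intro nn_integral_PInf_AE) auto
  define f where "f = (\<lambda>x. enn2real (g x))"
  have [measurable]: "f \<in> borel_measurable borel"
    unfolding f_def using g by simp
  have fg: "AE x in lborel. ennreal (f x) = g x"
    using fin by eventually_elim (simp add: f_def top.not_eq_extremum)
  then have M': "M = density lborel (\<lambda>x. ennreal (f x))"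
    unfolding M[symmetric] by (intro density_cong) (auto elim!: eventually_mono)
  have "(\<integral>\<^sup>+x. ennreal (f x) \<partial>lborel) = 1"
    using nn_integral_cong_AE[OF fg] g_int by simp
  then have int: "integrable lborel f"
    by (simp add: integrable_iff_bounded f_def)
  have "AE x in lborel. f x \<in> {..1}"
  proof (rule sigma_finite_measure.averaging_theorem[OF sigma_finite_lborel int closed_atMost])
    fix A :: "real set" assume A: "A \<in> sets lborel" "0 < measure lborel A"
    have [measurable]: "A \<in> sets borel" using A by simp
    have "ennreal (set_lebesgue_integral lborel A f) = (\<integral>\<^sup>+x. ennreal (indicator A x *\<^sub>R f x) \<partial>lborel)"
      unfolding set_lebesgue_integral_def using A int
      by (intro nn_integral_eq_integral[symmetric] integrable_mult_indicator) (auto simp: f_def)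
    also have "\<dots> = emeasure M A"
      unfolding M' by (simp add: emeasure_density indicator_def) (intro nn_integral_cong, auto)
    also have "\<dots> \<le> emeasure lborel A"
      by (rule le) simp
    \<comment> \<open>A positive \<open>measure\<close> rules out an infinite
      \<open>emeasure\<close>, for which \<open>measure\<close> would be 0.\<close>
    also have "\<dots> = ennreal (measure lborel A)"
      using A(2) by (intro emeasure_eq_ennreal_measure) (auto simp: measure_def)
    finally have "set_lebesgue_integral lborel A f \<le> measure lborel A"
      by simp
    then show "(1 / measure lborel A) *\<^sub>R set_lebesgue_integral lborel A f \<in> {..1}"
      using A(2) by (simp add: field_simps)
  qed
  then show thesis
    by (intro that[of f] M') (auto simp: f_def)
qed

section \<open>Laws with finite second moment and their quantile functions\<close>

lemma prob_measures_momentD: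
  assumes "\<mu> \<in> prob_measures_moment p (\<Omega> :: real set)"
  shows "real_distribution \<mu>" "emeasure \<mu> (- \<Omega>) = 0" "(\<integral>\<^sup>+x. ennreal (norm x powr p) \<partial>\<mu>) < \<infinity>"
  using assms by (auto simp: prob_measures_moment_def real_distribution_def real_distribution_axioms_def)

lemma distr_L2_in_prob_measures_moment:
  assumes "prob_space M" "f \<in> L2 M" "closed \<Omega>" "AE x in M. f x \<in> \<Omega>"
  shows "distr M borel f \<in> prob_measures_moment 2 \<Omega>"
proof -
  interpret prob_space M by fact
  have [measurable]: "f \<in> borel_measurable M"
    using assms by (intro L2_measurable)
  have "- \<Omega> \<in> sets borel"
    using assms by auto
  have "emeasure (distr M borel f) (- \<Omega>) = emeasure M (f -` (- \<Omega>) \<inter> space M)"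
    using \<open>- \<Omega> \<in> sets borel\<close> by (simp add: emeasure_distr)
  also have "f -` (- \<Omega>) \<inter> space M = {x \<in> space M. f x \<notin> \<Omega>}"
    by auto
  also have "emeasure M \<dots> = 0"
    using assms(4) by (intro emeasure_eq_0_AE) simp
  finally show ?thesis
    using assms(2) unfolding prob_measures_moment_def L2_def
    by (simp add: prob_space_distr nn_integral_distr powr_numeral integrable_iff_bounded)
qed

lemma quantile_L2:
  assumes "\<mu> \<in> prob_measures_moment 2 \<Omega>"
  shows "quantile \<mu> \<in> L2 unit_measure"
proof -
  interpret cdf_distribution \<mu>
    using prob_measures_momentD(1)[OF assms] by (simp add: cdf_distribution_def)
  have "(\<integral>\<^sup>+t. ennreal ((quantile \<mu> t)\<^sup>2) \<partial>unit_measure) = (\<integral>\<^sup>+x. ennreal (x\<^sup>2) \<partial>distr unit_measure borel (quantile \<mu>))"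
    by (simp add: nn_integral_distr)
  also have "\<dots> < \<infinity>"
    using prob_measures_momentD(3)[OF assms] by (simp add: distr_quantile powr_numeral)
  finally show ?thesis
    by (simp add: L2_def integrable_iff_bounded)
qed

lemma transport_cost_eq_sqdist:
  assumes "\<mu> \<in> prob_measures_moment 2 \<Omega>" "\<nu> \<in> prob_measures_moment 2 \<Omega>"
  shows "transport_cost 2 \<mu> \<nu> = ennreal (sqdist unit_measure (quantile \<mu>) (quantile \<nu>))"
  using assms by (simp add: transport_cost_eq_quantiles prob_measures_momentD nn_integral_sqdist quantile_L2)

text \<open>Quantile functions of densities bounded by 1 have slope at least 1. The exceptional null set
  makes the class closed under almost everywhere limits.\<close>

definition expanding_functions :: "real set \<Rightarrow> (real \<Rightarrow> real) set" where
  "expanding_functions \<Omega> = {f \<in> L2 unit_measure. \<exists>A. (AE t in unit_measure. t \<in> A) \<and>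
     (\<forall>t\<in>A. f t \<in> \<Omega>) \<and> (\<forall>s\<in>A. \<forall>t\<in>A. s < t \<longrightarrow> t - s \<le> f t - f s)}"

lemma expanding_functions_subset_L2: "expanding_functions \<Omega> \<subseteq> L2 unit_measure"
  by (auto simp: expanding_functions_def)

text \<open>A map of slope at least 1 pulls an interval back into an interval of the same length, up
  to a null set, so its law gives no interval more than its length.\<close>

lemma distr_expanding:
  assumes f: "f \<in> expanding_functions \<Omega>" and "closed \<Omega>"
  shows "distr unit_measure borel f \<in> bounded_density_measures 2 \<Omega>"
proof -
  obtain A where L2: "f \<in> L2 unit_measure" and AE_A: "AE t in unit_measure. t \<in> A" and A: "\<And>t. t \<in> A \<Longrightarrow> f t \<in> \<Omega>"
    and exp: "\<And>s t. s \<in> A \<Longrightarrow> t \<in> A \<Longrightarrow> s < t \<Longrightarrow> t - s \<le> f t - f s"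
    using f by (auto simp: expanding_functions_def)
  have [measurable]: "f \<in> borel_measurable unit_measure"
    using L2 by (rule L2_measurable)
  define \<rho> where "\<rho> = distr unit_measure borel f"
  interpret \<rho>: real_distribution \<rho>
    unfolding \<rho>_def by (rule unit_measure.real_distribution_distr) measurable
  have "measure \<rho> {a<..b} \<le> b - a" if "a \<le> b" for a b
  proof -
    define S where "S = {t. t \<in> A \<and> 0 < t \<and> t < 1 \<and> a < f t \<and> f t \<le> b}"
    \<comment> \<open>Points of \<open>S\<close> are at most \<open>b - a\<close> apart. The
      enclosing interval is measurable even if \<open>A\<close> is not; for empty \<open>S\<close>
      any value of \<open>Inf S\<close> will do.\<close>
    have sub: "S \<subseteq> {Inf S..Inf S + (b - a)}"
    proof
      fix t assume t: "t \<in> S"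
      have "Inf S \<le> t"
        using t by (intro cInf_lower bdd_belowI[of _ 0]) (auto simp: S_def)
      moreover have "t - (b - a) \<le> Inf S"
      proof (rule cInf_greatest)
        show "t - (b - a) \<le> s" if "s \<in> S" for s
          using exp[of s t] that t \<open>a \<le> b\<close> by (cases "s < t") (auto simp: S_def)
      qed (use t in auto)
      ultimately show "t \<in> {Inf S..Inf S + (b - a)}"
        by simp
    qed
    have "emeasure \<rho> {a<..b} = emeasure unit_measure (f -` {a<..b} \<inter> space unit_measure)"
      by (simp add: \<rho>_def emeasure_distr)
    also have "\<dots> \<le> emeasure unit_measure ({Inf S..Inf S + (b - a)} \<inter> {0<..<1})"
      using AE_A sub by (intro emeasure_mono_AE)
        (auto simp: space_unit_measure S_def sets_restrict_space elim!: eventually_mono)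
    also have "\<dots> \<le> emeasure lborel {Inf S..Inf S + (b - a)}"
      by (subst emeasure_restrict_space) (auto intro!: emeasure_mono)
    also have "\<dots> = ennreal (b - a)"
      using that by simp
    finally show ?thesis
      using that by (simp add: \<rho>.emeasure_eq_measure)
  qed
  note Ioc = this
  obtain g :: "real \<Rightarrow> real" where g: "g \<in> borel_measurable borel"
    "AE x in lborel. 0 \<le> g x \<and> g x \<le> 1" "\<rho> = density lborel (\<lambda>x. ennreal (g x))"
    by (rule \<rho>.density_le_1I[OF \<rho>.emeasure_le_lborel[OF Ioc]])
  moreover have "\<rho> \<in> prob_measures_moment 2 \<Omega>"
    unfolding \<rho>_def using AE_A A
    by (intro distr_L2_in_prob_measures_moment unit_measure.prob_space_axioms L2 assms) (auto elim!: eventually_mono)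
  ultimately show ?thesis
    unfolding bounded_density_measures_def \<rho>_def[symmetric] by blast
qed

text \<open>The density bound makes the distribution function 1-Lipschitz, so a mass of
  \<open>t - s\<close> between two quantiles needs at least that much room.\<close>

lemma quantile_expanding:
  assumes \<rho>: "\<rho> \<in> bounded_density_measures 2 \<Omega>" and "closed \<Omega>"
  shows "quantile \<rho> \<in> expanding_functions \<Omega>"
proof -
  have \<rho>': "\<rho> \<in> prob_measures_moment 2 \<Omega>"
    using \<rho> by (simp add: bounded_density_measures_def)
  interpret cdf_distribution \<rho>
    using prob_measures_momentD(1)[OF \<rho>'] by (simp add: cdf_distribution_def)
  obtain g :: "real \<Rightarrow> real" where g [measurable]: "g \<in> borel_measurable borel"
    and g_le: "AE x in lborel. 0 \<le> g x \<and> g x \<le> 1" and \<rho>_g: "\<rho> = density lborel (\<lambda>x. ennreal (g x))"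
    using \<rho> by (auto simp: bounded_density_measures_def)
  have cdf_diff: "cdf \<rho> b - cdf \<rho> a \<le> b - a" if "a \<le> b" for a b
  proof -
    have "emeasure \<rho> {a<..b} = (\<integral>\<^sup>+x. ennreal (g x) * indicator {a<..b} x \<partial>lborel)"
      unfolding \<rho>_g by (simp add: emeasure_density)
    also have "\<dots> \<le> (\<integral>\<^sup>+x. 1 * indicator {a<..b} x \<partial>lborel)"
    proof (rule nn_integral_mono_AE, use g_le in eventually_elim)
      case (elim x)
      then show ?case
        by (intro mult_right_mono) (simp_all add: ennreal_le_1)
    qed
    also have "\<dots> = ennreal (b - a)"
      using that by simp
    finally show ?thesis
      using that by (simp add: emeasure_Ioc)
  qed
  have "t - s \<le> quantile \<rho> t - quantile \<rho> s" if "0 < s" "s < t" "t < 1" for s t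
  proof -
    have t: "t \<le> cdf \<rho> (quantile \<rho> t)"
      using quantile_le_iff[of t "quantile \<rho> t"] that by simp
    \<comment> \<open>Strictly below the quantile of \<open>s\<close> the distribution function is
      less than \<open>s\<close>, so the mass from \<open>x\<close> to the quantile of
      \<open>t\<close> exceeds \<open>t - s\<close>. Then \<open>x\<close> increases to the quantile
      of \<open>s\<close>.\<close>
    have s: "x \<le> quantile \<rho> t - (t - s)" if "x < quantile \<rho> s" for x
    proof -
      have "cdf \<rho> x < s"
        using quantile_le_iff[of s x] that \<open>0 < s\<close> \<open>s < t\<close> \<open>t < 1\<close> by auto
      moreover have "x \<le> quantile \<rho> t"
        using quantile_le_iff[of t x] \<open>cdf \<rho> x < s\<close> \<open>0 < s\<close> \<open>s < t\<close> \<open>t < 1\<close> by auto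
      ultimately show ?thesis
        using cdf_diff[of x "quantile \<rho> t"] t by simp
    qed
    then have "quantile \<rho> s \<le> quantile \<rho> t - (t - s)"
      by (rule dense_le)
    then show ?thesis by simp
  qed
  moreover have "AE t in unit_measure. quantile \<rho> t \<in> \<Omega>"
  proof -
    have "AE x in distr unit_measure borel (quantile \<rho>). x \<in> \<Omega>"
      unfolding distr_quantile using prob_measures_momentD(2)[OF \<rho>'] \<open>closed \<Omega>\<close>
      by (intro AE_I[where N = "- \<Omega>"]) (auto simp: M_is_borel)
    then show ?thesis
      using \<open>closed \<Omega>\<close> by (subst (asm) AE_distr_iff) auto
  qed
  then have "AE t in unit_measure. t \<in> {t. 0 < t \<and> t < 1 \<and> quantile \<rho> t \<in> \<Omega>}"
    using AE_unit_measure by eventually_elim simp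
  ultimately show ?thesis
    unfolding expanding_functions_def using quantile_L2[OF \<rho>']
    by (auto intro!: exI[of _ "{t. 0 < t \<and> t < 1 \<and> quantile \<rho> t \<in> \<Omega>}"])
qed

text \<open>The conditions are pointwise, namely weak inequalities and membership in a closed convex
  set, so they survive segments and limits. The countably many exceptional sets combine to a null
  set.\<close>

lemma L2_closed_convex_expanding:
  assumes "closed \<Omega>" "convex \<Omega>"
  shows "L2_closed_convex unit_measure (expanding_functions \<Omega>)"
proof
  show "expanding_functions \<Omega> \<subseteq> L2 unit_measure"
    by (rule expanding_functions_subset_L2)
next
  fix f g and u :: real
  assume f: "f \<in> expanding_functions \<Omega>" and g: "g \<in> expanding_functions \<Omega>" and u: "0 \<le> u" "u \<le> 1"
  let ?h = "\<lambda>x. f x + u * (g x - f x)"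
  obtain A where A: "f \<in> L2 unit_measure" "AE t in unit_measure. t \<in> A" "\<And>t. t \<in> A \<Longrightarrow> f t \<in> \<Omega>"
    "\<And>s t. s \<in> A \<Longrightarrow> t \<in> A \<Longrightarrow> s < t \<Longrightarrow> t - s \<le> f t - f s"
    using f by (auto simp: expanding_functions_def)
  obtain B where B: "g \<in> L2 unit_measure" "AE t in unit_measure. t \<in> B" "\<And>t. t \<in> B \<Longrightarrow> g t \<in> \<Omega>"
    "\<And>s t. s \<in> B \<Longrightarrow> t \<in> B \<Longrightarrow> s < t \<Longrightarrow> t - s \<le> g t - g s"
    using g by (auto simp: expanding_functions_def)
  have "?h \<in> L2 unit_measure"
    by (intro L2_add L2_scale L2_diff A B)
  moreover have "AE t in unit_measure. t \<in> A \<inter> B"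
    using A(2) B(2) by eventually_elim simp
  moreover have "?h t \<in> \<Omega>" if "t \<in> A \<inter> B" for t
    using convexD_alt[OF \<open>convex \<Omega>\<close> A(3) B(3) u, of t t] that by (simp add: algebra_simps)
  moreover have "t - s \<le> ?h t - ?h s" if "s \<in> A \<inter> B" "t \<in> A \<inter> B" "s < t" for s t
  proof -
    have "(1 - u) * (t - s) + u * (t - s) \<le> (1 - u) * (f t - f s) + u * (g t - g s)"
      using that u by (intro add_mono mult_left_mono A B) auto
    then show ?thesis
      by (simp add: algebra_simps)
  qed
  ultimately show "?h \<in> expanding_functions \<Omega>"
    unfolding expanding_functions_def by blast
next
  fix F f
  assume F: "\<And>n::nat. F n \<in> expanding_functions \<Omega>" and f: "f \<in> L2 unit_measure"
    and lim: "AE t in unit_measure. (\<lambda>n. F n t) \<longlonglongrightarrow> f t"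
  have "\<forall>n. \<exists>A. (AE t in unit_measure. t \<in> A) \<and> (\<forall>t\<in>A. F n t \<in> \<Omega>) \<and>
      (\<forall>s\<in>A. \<forall>t\<in>A. s < t \<longrightarrow> t - s \<le> F n t - F n s)"
    using F by (simp add: expanding_functions_def)
  then obtain A where A: "\<And>n. AE t in unit_measure. t \<in> A n" "\<And>n t. t \<in> A n \<Longrightarrow> F n t \<in> \<Omega>"
    "\<And>n s t. s \<in> A n \<Longrightarrow> t \<in> A n \<Longrightarrow> s < t \<Longrightarrow> t - s \<le> F n t - F n s"
    by metis
  define B where "B = {t. (\<forall>n. t \<in> A n) \<and> (\<lambda>n. F n t) \<longlonglongrightarrow> f t}"
  have "AE t in unit_measure. \<forall>n. t \<in> A n"
    using A(1) by (simp add: AE_all_countable)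
  then have "AE t in unit_measure. t \<in> B"
    using lim by eventually_elim (simp add: B_def)
  moreover have "f t \<in> \<Omega>" if "t \<in> B" for t
  proof (rule closed_sequentially[OF \<open>closed \<Omega>\<close>])
    show "F n t \<in> \<Omega>" for n
      using that by (intro A(2)[of t n]) (simp add: B_def)
    show "(\<lambda>n. F n t) \<longlonglongrightarrow> f t"
      using that by (simp add: B_def)
  qed
  moreover have "t - s \<le> f t - f s" if "s \<in> B" "t \<in> B" "s < t" for s t
  proof (rule LIMSEQ_le_const)
    show "(\<lambda>n. F n t - F n s) \<longlonglongrightarrow> f t - f s"
      using that by (intro tendsto_diff) (simp_all add: B_def)
    show "\<exists>N. \<forall>n\<ge>N. t - s \<le> F n t - F n s"
      using that by (intro exI[of _ 0] allI impI A(3)) (simp_all add: B_def)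
  qed
  ultimately show "f \<in> expanding_functions \<Omega>"
    unfolding expanding_functions_def using f by blast
qed

text \<open>This provides room for an admissible law. A bounded \<open>\<Omega>\<close> is some
  \<open>{c..d}\<close> of length at least 1; an unbounded one leaves every ball of radius
  1.\<close>

lemma closed_interval_contains_unit_interval:
  assumes "closed \<Omega>" "is_interval \<Omega>" "1 \<le> emeasure lborel \<Omega>"
  obtains a :: real where "{a..a + 1} \<subseteq> \<Omega>"
proof -
  have "\<exists>x\<in>\<Omega>. \<exists>y\<in>\<Omega>. 1 \<le> y - x"
  proof (cases "bounded \<Omega>")
    case True
    then have "compact \<Omega>" "connected \<Omega>"
      using assms by (auto simp: compact_eq_bounded_closed is_interval_connected)
    then obtain c d where \<Omega>: "\<Omega> = {c..d}"
      using connected_compact_interval_1 by blast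
    then have "1 \<le> d - c"
      using assms(3) by (cases "c \<le> d") auto
    then show ?thesis
      unfolding \<Omega> by (intro bexI[of _ c] bexI[of _ d]) auto
  next
    case False
    then obtain x where x: "x \<in> \<Omega>"
      using bounded_empty[where 'a = real] by (cases "\<Omega> = {}") auto
    have "\<not> \<Omega> \<subseteq> cball x 1"
      using False bounded_subset bounded_cball by blast
    then obtain y where "y \<in> \<Omega>" "y \<notin> cball x 1"
      by blast
    then have "y \<in> \<Omega>" "1 < \<bar>x - y\<bar>"
      by (simp_all add: dist_real_def)
    then show ?thesis
      using x by (cases "x \<le> y") (force simp: abs_if split: if_splits)+
  qed
  then obtain x y where xy: "x \<in> \<Omega>" "y \<in> \<Omega>" "1 \<le> y - x"
    by blast
  then have "{x..x + 1} \<subseteq> \<Omega>"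
    using mem_is_interval_1_I[OF assms(2) xy(1,2)] by auto
  then show thesis
    by (rule that)
qed

text \<open>The witness is the quantile function of the uniform law on
  \<open>{a..a + 1}\<close>.\<close>

lemma expanding_functions_nonempty:
  assumes "{a..a + 1} \<subseteq> \<Omega>"
  shows "expanding_functions \<Omega> \<noteq> {}"
proof -
  have "(\<lambda>t. a + t) \<in> L2 unit_measure"
  proof -
    have [measurable]: "(\<lambda>t. a + t) \<in> borel_measurable unit_measure"
      by (intro measurable_restrict_space1) simp
    have "AE t in unit_measure. norm ((a + t)\<^sup>2) \<le> (\<bar>a\<bar> + 1)\<^sup>2"
      using AE_unit_measure
    proof eventually_elim
      case (elim t)
      then have "\<bar>a + t\<bar>\<^sup>2 \<le> (\<bar>a\<bar> + 1)\<^sup>2"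
        by (intro power_mono) auto
      then show ?case by simp
    qed
    then show ?thesis
      unfolding L2_def by (auto intro!: unit_measure.integrable_const_bound)
  qed
  then have "(\<lambda>t. a + t) \<in> expanding_functions \<Omega>"
    unfolding expanding_functions_def using assms AE_unit_measure
    by (auto intro!: exI[of _ "{0<..<1}"])
  then show ?thesis by blast
qed

section \<open>The projection of measures\<close>

lemma bounded_density_measuresD:
  "\<rho> \<in> bounded_density_measures p \<Omega> \<Longrightarrow> \<rho> \<in> prob_measures_moment p \<Omega>"
  by (simp add: bounded_density_measures_def)

text \<open>Minimality passes from measures to functions: the law of \<open>k\<close> is an
  admissible competitor, and pairing \<open>k\<close> with \<open>quantile \<mu>\<close> gives a
  coupling whose cost is the right side.\<close>

lemma sqdist_le_of_is_arg_min:
  assumes "closed \<Omega>" and \<mu>: "\<mu> \<in> prob_measures_moment 2 \<Omega>"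
    and min: "is_arg_min (\<lambda>\<rho>. transport_cost 2 \<rho> \<mu>) (\<lambda>\<rho>. \<rho> \<in> bounded_density_measures 2 \<Omega>) \<rho>"
    and k: "k \<in> expanding_functions \<Omega>"
  shows "sqdist unit_measure (quantile \<rho>) (quantile \<mu>) \<le> sqdist unit_measure k (quantile \<mu>)"
proof -
  interpret \<mu>: cdf_distribution \<mu>
    using prob_measures_momentD(1)[OF \<mu>] by (simp add: cdf_distribution_def)
  have kL: "k \<in> L2 unit_measure"
    using k expanding_functions_subset_L2 by blast
  have \<rho>: "\<rho> \<in> prob_measures_moment 2 \<Omega>"
    using min by (auto simp: is_arg_min_def bounded_density_measures_def)
  have "ennreal (sqdist unit_measure (quantile \<rho>) (quantile \<mu>)) = transport_cost 2 \<rho> \<mu>"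
    by (simp add: transport_cost_eq_sqdist[OF \<rho> \<mu>])
  also have "\<dots> \<le> transport_cost 2 (distr unit_measure borel k) \<mu>"
    using min distr_expanding[OF k \<open>closed \<Omega>\<close>] by (auto simp: is_arg_min_def not_less)
  also have "\<dots> \<le> (\<integral>\<^sup>+t. ennreal ((k t - quantile \<mu> t)\<^sup>2) \<partial>unit_measure)"
    using transport_cost_distr_le[OF L2_measurable[OF kL] \<mu>.measurable_quantile]
    by (simp only: \<mu>.distr_quantile)
  also have "\<dots> = ennreal (sqdist unit_measure k (quantile \<mu>))"
    by (rule nn_integral_sqdist[OF kL quantile_L2[OF \<mu>]])
  finally show ?thesis
    by (simp add: sqdist_nonneg)
qed

text \<open>The law of the projected quantile function is a minimizer. Any two minimizers have
  quantile functions that agree almost everywhere, hence they are equal, and the definite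
  description denotes the minimizer.\<close>

lemma wasserstein_projection_is_arg_min:
  fixes \<Omega> :: "real set"
  assumes \<Omega>: "closed \<Omega>" "is_interval \<Omega>" "1 \<le> emeasure lborel \<Omega>" and \<mu>: "\<mu> \<in> prob_measures_moment 2 \<Omega>"
  shows "is_arg_min (\<lambda>\<rho>. transport_cost 2 \<rho> \<mu>) (\<lambda>\<rho>. \<rho> \<in> bounded_density_measures 2 \<Omega>)
    (wasserstein_projection 2 \<Omega> \<mu>)"
  unfolding wasserstein_projection_def
proof (rule theI')
  interpret E: L2_closed_convex unit_measure "expanding_functions \<Omega>"
    using \<Omega> by (intro L2_closed_convex_expanding) (auto simp: is_interval_convex)
  interpret \<mu>: cdf_distribution \<mu>
    using prob_measures_momentD(1)[OF \<mu>] by (simp add: cdf_distribution_def)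
  let ?min = "is_arg_min (\<lambda>\<rho>. transport_cost 2 \<rho> \<mu>) (\<lambda>\<rho>. \<rho> \<in> bounded_density_measures 2 \<Omega>)"
  obtain f where f: "f \<in> expanding_functions \<Omega>"
    and f_min: "\<And>k. k \<in> expanding_functions \<Omega> \<Longrightarrow>
      sqdist unit_measure f (quantile \<mu>) \<le> sqdist unit_measure k (quantile \<mu>)"
    using closed_interval_contains_unit_interval[OF \<Omega>] expanding_functions_nonempty
      E.projection_exists[OF quantile_L2[OF \<mu>]] by metis
  have fL: "f \<in> L2 unit_measure"
    using f expanding_functions_subset_L2 by blast
  have "transport_cost 2 (distr unit_measure borel f) \<mu> \<le> transport_cost 2 \<rho> \<mu>"
    if "\<rho> \<in> bounded_density_measures 2 \<Omega>" for \<rho>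
  proof -
    have "transport_cost 2 (distr unit_measure borel f) \<mu> \<le> ennreal (sqdist unit_measure f (quantile \<mu>))"
      using transport_cost_distr_le[OF L2_measurable[OF fL] \<mu>.measurable_quantile]
      by (simp only: \<mu>.distr_quantile nn_integral_sqdist[OF fL quantile_L2[OF \<mu>]])
    also have "\<dots> \<le> ennreal (sqdist unit_measure (quantile \<rho>) (quantile \<mu>))"
      by (intro ennreal_leI f_min quantile_expanding that \<Omega>)
    finally show ?thesis
      by (simp add: transport_cost_eq_sqdist[OF bounded_density_measuresD[OF that] \<mu>])
  qed
  then have "?min (distr unit_measure borel f)"
    using distr_expanding[OF f \<Omega>(1)] by (auto simp: is_arg_min_def not_less)
  moreover have "\<rho> = \<sigma>" if "?min \<rho>" "?min \<sigma>" for \<rho> \<sigma>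
  proof -
    have K: "\<rho> \<in> bounded_density_measures 2 \<Omega>" "\<sigma> \<in> bounded_density_measures 2 \<Omega>"
      using that by (simp_all add: is_arg_min_def)
    interpret \<rho>: cdf_distribution \<rho>
      using prob_measures_momentD(1)[OF bounded_density_measuresD[OF K(1)]] by (simp add: cdf_distribution_def)
    interpret \<sigma>: cdf_distribution \<sigma>
      using prob_measures_momentD(1)[OF bounded_density_measuresD[OF K(2)]] by (simp add: cdf_distribution_def)
    have "AE t in unit_measure. quantile \<rho> t = quantile \<sigma> t"
      by (rule E.minimizers_AE_eq[OF quantile_L2[OF \<mu>] K[THEN quantile_expanding[OF _ \<Omega>(1)]]])
        (use sqdist_le_of_is_arg_min[OF \<Omega>(1) \<mu>] that in auto)
    then have "distr unit_measure borel (quantile \<rho>) = distr unit_measure borel (quantile \<sigma>)"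
      by (intro distr_cong_AE) auto
    then show ?thesis
      by (simp only: \<rho>.distr_quantile \<sigma>.distr_quantile)
  qed
  ultimately show "\<exists>!\<rho>. ?min \<rho>"
    by blast
qed

theorem corollary3p2:
  fixes \<Omega> :: "real set"
  assumes "closed \<Omega>" and "is_interval \<Omega>" and "emeasure lborel \<Omega> \<ge> 1"
  shows "\<forall>\<mu>\<in>prob_measures_moment 2 \<Omega>. \<forall>\<nu>\<in>prob_measures_moment 2 \<Omega>.
    wasserstein 2 (wasserstein_projection 2 \<Omega> \<mu>) (wasserstein_projection 2 \<Omega> \<nu>)
      \<le> wasserstein 2 \<mu> \<nu>"
proof (intro ballI)
  fix \<mu> \<nu> assume \<mu>: "\<mu> \<in> prob_measures_moment 2 \<Omega>" and \<nu>: "\<nu> \<in> prob_measures_moment 2 \<Omega>"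
  interpret E: L2_closed_convex unit_measure "expanding_functions \<Omega>"
    using assms by (intro L2_closed_convex_expanding) (auto simp: is_interval_convex)
  define P where "P = wasserstein_projection 2 \<Omega>"
  have min: "is_arg_min (\<lambda>\<rho>. transport_cost 2 \<rho> \<kappa>) (\<lambda>\<rho>. \<rho> \<in> bounded_density_measures 2 \<Omega>) (P \<kappa>)"
    if "\<kappa> \<in> prob_measures_moment 2 \<Omega>" for \<kappa>
    unfolding P_def using assms that by (rule wasserstein_projection_is_arg_min)
  have K: "P \<kappa> \<in> bounded_density_measures 2 \<Omega>" if "\<kappa> \<in> prob_measures_moment 2 \<Omega>" for \<kappa>
    using min[OF that] by (simp add: is_arg_min_def)
  \<comment> \<open>The quantile functions of the projected measures minimize the distance to those
    of \<open>\<mu>\<close> and \<open>\<nu>\<close>, so the Hilbert space estimate applies.\<close>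
  have "sqdist unit_measure (quantile (P \<mu>)) (quantile (P \<nu>)) \<le> sqdist unit_measure (quantile \<mu>) (quantile \<nu>)"
    by (rule E.projection_nonexpansive[OF quantile_L2[OF \<mu>] quantile_L2[OF \<nu>]
        quantile_expanding[OF K[OF \<mu>] assms(1)] quantile_expanding[OF K[OF \<nu>] assms(1)]
        sqdist_le_of_is_arg_min[OF assms(1) \<mu> min[OF \<mu>]]
        sqdist_le_of_is_arg_min[OF assms(1) \<nu> min[OF \<nu>]]])
  then have "wasserstein 2 (P \<mu>) (P \<nu>) \<le> wasserstein 2 \<mu> \<nu>"
    unfolding wasserstein_def transport_cost_eq_sqdist[OF \<mu> \<nu>]
      transport_cost_eq_sqdist[OF bounded_density_measuresD[OF K[OF \<mu>]] bounded_density_measuresD[OF K[OF \<nu>]]]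
    by (intro powr_mono2) (simp_all add: sqdist_nonneg)
  then show "wasserstein 2 (wasserstein_projection 2 \<Omega> \<mu>) (wasserstein_projection 2 \<Omega> \<nu>) \<le> wasserstein 2 \<mu> \<nu>"
    by (simp add: P_def)
qed

end
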